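(* Let $(S,\prec_S)$ and $(T,\prec_T)$ be $\mathrm{W}$-semigroups with $T$ faithful, let $f\colon S\to T$ be a $\mathrm{W}$-morphism, let $\alpha=(\prec_S,\leq)$ be a $\prec_S$-normal pair on $S$, and let $\pi_\alpha\colon S\to S/\alpha$ be the natural quotient $\mathrm{W}$-morphism. Then there is an order-preserving $\mathrm{W}$-morphism $h\colon S/\alpha\to T$ such that $h\circ\pi_\alpha=f$ if and only if $\alpha\leq\ker(f)$. Furthermore, $\alpha=\ker(f)$ if and only if such an $h$ exists and is an order-embedding.
   Context: Relations: for relations $R_1,R_2$ on a set $X$, $R_1\circ R_2=\{(a,b):\exists c,\ a\,R_1\,c \text{ and } c\,R_2\,b\}$ (similarly for longer compositions). For a relation $\prec$ on $X$ and $a\in X$, $a^{\prec}=\{b\in X: b\prec a\}$; the induced preorder is $a\leq_\prec b \iff a^\prec\subseteq b^\prec$. A relation $\prec$ is auxiliary for a preorder $\leq$ if $a\prec b$ implies $a\leq b$, and $a\leq b\prec c\leq d$ implies $a\prec d$. $\mathrm{W}$-semigroups: a $\mathrm{W}$-semigroup $(S,\prec)$ is an abelian monoid $S$ with a transitive relation $\prec$ such that: $0\prec a$ for all $a$; (W1) for each $a$ there is a sequence $(a_k)$ in $a^\prec$ with $a_k\prec a_{k+1}$ for all $k$ and such that every $b\prec a$ satisfies $b\prec a_k$ for some $k$; (W3) $a'\prec a$ and $b'\prec b$ imply $a'+b'\prec a+b$; (W4) $a\prec b+c$ implies there are $b'\prec b$, $c'\prec c$ with $a\prec b'+c'$. A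 $\mathrm{W}$-morphism $f\colon(S,\prec_S)\to(T,\prec_T)$ is an additive map with $f(0)=0$ that is monotone ($a\prec_S b\Rightarrow f(a)\prec_T f(b)$) and continuous (if $b\prec_T f(a)$ there is $a'\prec_S a$ with $b\prec_T f(a')$). A $\mathrm{W}$-semigroup $(T,\prec_T)$ is faithful if $\prec_T$ is auxiliary for $\leq_{\prec_T}$, the preorder $\leq_{\prec_T}$ is a partial order, and (W2) holds: for $a,c\in T$, if $b\leq_{\prec_T} c$ for all $b\prec_T a$ then $a\leq_{\prec_T} c$. The order on $T$ is $\leq_{\prec_T}$. Normal pairs: for a preorder $\leq$ on $S$, the pair $(\prec_S,\leq)$ is admissible if $a^{\leq\circ\prec_S}\subseteq b^{\leq\circ\prec_S}$ implies $a\leq b$. It is $\prec_S$-normal if it is admissible, $\leq$ is additively closed ($a_i\leq b_i$, $i=1,2$, implies $a_1+a_2\leq b_1+b_2$), and $\leq$ is left $\prec_S$-continuous: $\prec_S\circ\leq\ \subseteq\ \prec_S\circ\leq\circ\prec_S$. Order of pairs: $(\prec_1,\leq_1)\leq(\prec_2,\leq_2)$ means $\prec_1\subseteq\prec_2$, $\leq_1\subseteq\leq_2$, and $a^{\leq_1\circ\prec_1}\subseteq b^{\leq_1\circ\prec_1}$ implies $a^{\leq_2\circ\prec_2}\subseteq b^{\leq_2\circ\prec_2}$. Kernel: $\ker(f)=(\prec_S,\leq_f)$, where $a\leq_f b\iff f(a)^{\prec_T}\subseteq f(b)^{\prec_T}$. Quotient: $S/\alpha$ is the set of classes of $S$ modulo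 $a\sim b\iff a\leq b\leq a$, with induced addition, partial order $[a]\leq[b]\iff a\leq b$, and relation $[a]\prec_\alpha[b]\iff$ there is $a'\in S$ with $a\leq a'\prec_S b$; $\pi_\alpha(a)=[a]$. A map $h$ is an order-embedding if $x\leq y\iff h(x)\leq h(y)$. *)

theory Defs
  imports "HOL-Algebra.Group"
begin

text \<open>
  The abelian monoid is an HOL-Algebra \<^const>\<open>comm_monoid\<close>, so \<open>\<otimes>\<close> and \<open>\<one>\<close> stand for the
  addition and the zero of the semigroup. All relations on a set are sets of pairs, so that
  \<open>a\<^sup>\<prec>\<close> is \<^const>\<open>under\<close> of \<open>\<prec>\<close> at \<open>a\<close>, and composition is the library's \<open>O\<close>.
\<close>

record 'a w_semigroup = "'a monoid" +
  prec :: "'a rel"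

definition induced_le :: "'a set \<Rightarrow> 'a rel \<Rightarrow> 'a rel" where
  "induced_le X r = {(a, b). a \<in> X \<and> b \<in> X \<and> under r a \<subseteq> under r b}"

definition auxiliary :: "'a rel \<Rightarrow> 'a rel \<Rightarrow> bool" where
  "auxiliary r leq \<longleftrightarrow> r \<subseteq> leq \<and> leq O r O leq \<subseteq> r"

locale W_semigroup = comm_monoid S for S :: "('a, 'b) w_semigroup_scheme" (structure) +
  assumes prec_subset: "prec S \<subseteq> carrier S \<times> carrier S"
    and prec_trans: "trans (prec S)"
    and zero_prec: "a \<in> carrier S \<Longrightarrow> (\<one>, a) \<in> prec S"
    and W1: "a \<in> carrier S \<Longrightarrow>
      \<exists>s :: nat \<Rightarrow> 'a. (\<forall>k. s k \<in> under (prec S) a) \<and> (\<forall>k. (s k, s (Suc k)) \<in> prec S) \<and>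
        (\<forall>b \<in> under (prec S) a. \<exists>k. (b, s k) \<in> prec S)"
    and W3: "(a', a) \<in> prec S \<Longrightarrow> (b', b) \<in> prec S \<Longrightarrow> (a' \<otimes> b', a \<otimes> b) \<in> prec S"
    and W4: "b \<in> carrier S \<Longrightarrow> c \<in> carrier S \<Longrightarrow> (a, b \<otimes> c) \<in> prec S \<Longrightarrow>
      \<exists>b' c'. (b', b) \<in> prec S \<and> (c', c) \<in> prec S \<and> (a, b' \<otimes> c') \<in> prec S"

abbreviation W_le :: "('a, 'b) w_semigroup_scheme \<Rightarrow> 'a rel" where
  "W_le S \<equiv> induced_le (carrier S) (prec S)"

locale faithful_W_semigroup = W_semigroup T for T :: "('a, 'b) w_semigroup_scheme" (structure) +
  assumes prec_auxiliary: "auxiliary (prec T) (W_le T)"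
    and W_le_partial_order: "partial_order_on (carrier T) (W_le T)"
    and W2: "a \<in> carrier T \<Longrightarrow> c \<in> carrier T \<Longrightarrow>
      (\<And>b. (b, a) \<in> prec T \<Longrightarrow> (b, c) \<in> W_le T) \<Longrightarrow> (a, c) \<in> W_le T"

locale W_morphism = S: W_semigroup S + T: W_semigroup T
  for S :: "('a, 'c) w_semigroup_scheme" and T :: "('b, 'd) w_semigroup_scheme"
    and f :: "'a \<Rightarrow> 'b" +
  assumes additive: "f \<in> hom S T"
    and zero: "f \<one>\<^bsub>S\<^esub> = \<one>\<^bsub>T\<^esub>"
    and monotone: "(a, b) \<in> prec S \<Longrightarrow> (f a, f b) \<in> prec T"
    and continuous: "a \<in> carrier S \<Longrightarrow> (y, f a) \<in> prec T \<Longrightarrow>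
      \<exists>a'. (a', a) \<in> prec S \<and> (y, f a') \<in> prec T"

definition admissible_pair :: "'a set \<Rightarrow> 'a rel \<times> 'a rel \<Rightarrow> bool" where
  "admissible_pair X \<alpha> \<longleftrightarrow> (\<forall>a\<in>X. \<forall>b\<in>X.
     under (snd \<alpha> O fst \<alpha>) a \<subseteq> under (snd \<alpha> O fst \<alpha>) b \<longrightarrow> (a, b) \<in> snd \<alpha>)"

definition normal_pair :: "('a, 'b) w_semigroup_scheme \<Rightarrow> 'a rel \<times> 'a rel \<Rightarrow> bool" where
  "normal_pair S \<alpha> \<longleftrightarrow>
     fst \<alpha> = prec S \<and>
     preorder_on (carrier S) (snd \<alpha>) \<and>
     admissible_pair (carrier S) \<alpha> \<and>
     (\<forall>(a\<^sub>1, b\<^sub>1) \<in> snd \<alpha>. \<forall>(a\<^sub>2, b\<^sub>2) \<in> snd \<alpha>. (a\<^sub>1 \<otimes>\<^bsub>S\<^esub> a\<^sub>2, b\<^sub>1 \<otimes>\<^bsub>S\<^esub> b\<^sub>2) \<in> snd \<alpha>) \<and>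
     prec S O snd \<alpha> \<subseteq> prec S O snd \<alpha> O prec S"

definition pair_le :: "'a set \<Rightarrow> 'a rel \<times> 'a rel \<Rightarrow> 'a rel \<times> 'a rel \<Rightarrow> bool" where
  "pair_le X \<alpha> \<beta> \<longleftrightarrow>
     fst \<alpha> \<subseteq> fst \<beta> \<and> snd \<alpha> \<subseteq> snd \<beta> \<and>
     (\<forall>a\<in>X. \<forall>b\<in>X. under (snd \<alpha> O fst \<alpha>) a \<subseteq> under (snd \<alpha> O fst \<alpha>) b \<longrightarrow>
        under (snd \<beta> O fst \<beta>) a \<subseteq> under (snd \<beta> O fst \<beta>) b)"

definition W_ker :: "('a, 'c) w_semigroup_scheme \<Rightarrow> ('b, 'd) w_semigroup_scheme \<Rightarrow>
    ('a \<Rightarrow> 'b) \<Rightarrow> 'a rel \<times> 'a rel" where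
  "W_ker S T f = (prec S,
     {(a, b). a \<in> carrier S \<and> b \<in> carrier S \<and> under (prec T) (f a) \<subseteq> under (prec T) (f b)})"

definition quot_rel :: "'a rel \<times> 'a rel \<Rightarrow> 'a rel" where
  "quot_rel \<alpha> = {(a, b). (a, b) \<in> snd \<alpha> \<and> (b, a) \<in> snd \<alpha>}"

definition quot_proj :: "'a rel \<times> 'a rel \<Rightarrow> 'a \<Rightarrow> 'a set" where
  "quot_proj \<alpha> a = quot_rel \<alpha> `` {a}"

definition quot :: "('a, 'b) w_semigroup_scheme \<Rightarrow> 'a rel \<times> 'a rel \<Rightarrow> 'a set w_semigroup" where
  "quot S \<alpha> = \<lparr>
     carrier = carrier S // quot_rel \<alpha>,
     mult = (\<lambda>A B. \<Union>a\<in>A. \<Union>b\<in>B. quot_proj \<alpha> (a \<otimes>\<^bsub>S\<^esub> b)),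
     one = quot_proj \<alpha> \<one>\<^bsub>S\<^esub>,
     prec = {(quot_proj \<alpha> a, quot_proj \<alpha> b) | a b. (a, b) \<in> snd \<alpha> O prec S}\<rparr>"

definition quot_le :: "'a rel \<times> 'a rel \<Rightarrow> 'a set rel" where
  "quot_le \<alpha> = {(quot_proj \<alpha> a, quot_proj \<alpha> b) | a b. (a, b) \<in> snd \<alpha>}"

definition order_preserving :: "'a set \<Rightarrow> 'a rel \<Rightarrow> 'b rel \<Rightarrow> ('a \<Rightarrow> 'b) \<Rightarrow> bool" where
  "order_preserving X r s h \<longleftrightarrow> (\<forall>x\<in>X. \<forall>y\<in>X. (x, y) \<in> r \<longrightarrow> (h x, h y) \<in> s)"

definition order_embedding :: "'a set \<Rightarrow> 'a rel \<Rightarrow> 'b rel \<Rightarrow> ('a \<Rightarrow> 'b) \<Rightarrow> bool" where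
  "order_embedding X r s h \<longleftrightarrow> (\<forall>x\<in>X. \<forall>y\<in>X. (x, y) \<in> r \<longleftrightarrow> (h x, h y) \<in> s)"

text \<open>For a normal pair, none of the quotient operations depends on representatives.\<close>

context W_semigroup
begin

context
  fixes \<alpha> :: "'a rel \<times> 'a rel"
  assumes normal: "normal_pair S \<alpha>"
begin

lemma snd_preorder: "preorder_on (carrier S) (snd \<alpha>)"
  using normal by (simp add: normal_pair_def)

lemma snd_refl: "a \<in> carrier S \<Longrightarrow> (a, a) \<in> snd \<alpha>"
  using snd_preorder by (simp add: preorder_on_def refl_on_def)

lemma snd_trans: "(a, b) \<in> snd \<alpha> \<Longrightarrow> (b, c) \<in> snd \<alpha> \<Longrightarrow> (a, c) \<in> snd \<alpha>"
  using snd_preorder unfolding preorder_on_def by (elim conjE) (rule transD)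

lemma snd_carrier: "(a, b) \<in> snd \<alpha> \<Longrightarrow> a \<in> carrier S \<and> b \<in> carrier S"
  using snd_preorder by (auto simp: preorder_on_def)

lemma snd_add: "(a, b) \<in> snd \<alpha> \<Longrightarrow> (c, d) \<in> snd \<alpha> \<Longrightarrow> (a \<otimes> c, b \<otimes> d) \<in> snd \<alpha>"
  using normal by (simp add: normal_pair_def split_beta Ball_def)

lemma snd_left_cont: "(a, b) \<in> prec S \<Longrightarrow> (b, c) \<in> snd \<alpha> \<Longrightarrow> (a, c) \<in> prec S O snd \<alpha> O prec S"
proof -
  assume "(a, b) \<in> prec S" "(b, c) \<in> snd \<alpha>"
  then have "(a, c) \<in> prec S O snd \<alpha>" by (rule relcompI)
  then show ?thesis using normal by (simp add: normal_pair_def subset_iff)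
qed

lemma prec_subset_snd: "(a, b) \<in> prec S \<Longrightarrow> (a, b) \<in> snd \<alpha>"
proof -
  assume ab: "(a, b) \<in> prec S"
  then have "under (snd \<alpha> O prec S) a \<subseteq> under (snd \<alpha> O prec S) b"
    unfolding under_def using transD[OF prec_trans _ ab] by blast
  moreover have "fst \<alpha> = prec S" "admissible_pair (carrier S) \<alpha>"
    using normal by (simp_all add: normal_pair_def)
  moreover have "a \<in> carrier S" "b \<in> carrier S"
    using ab prec_subset by auto
  ultimately show ?thesis
    by (simp add: admissible_pair_def)
qed

lemma quot_rel_equiv: "equiv (carrier S) (quot_rel \<alpha>)"
proof (intro equivI refl_onI symI transI)
  show "quot_rel \<alpha> \<subseteq> carrier S \<times> carrier S"
    using snd_preorder by (auto simp: preorder_on_def quot_rel_def)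
next
  fix a b c assume "(a, b) \<in> quot_rel \<alpha>" "(b, c) \<in> quot_rel \<alpha>"
  then show "(a, c) \<in> quot_rel \<alpha>"
    using snd_trans[of a b c] snd_trans[of c b a] by (simp add: quot_rel_def)
qed (simp_all add: quot_rel_def snd_refl)

lemma quot_proj_eq_iff:
  assumes "a \<in> carrier S" "b \<in> carrier S"
  shows "quot_proj \<alpha> a = quot_proj \<alpha> b \<longleftrightarrow> (a, b) \<in> snd \<alpha> \<and> (b, a) \<in> snd \<alpha>"
  using eq_equiv_class_iff[OF quot_rel_equiv assms] by (simp add: quot_proj_def quot_rel_def)

lemma quot_proj_add:
  assumes "a \<in> carrier S" "b \<in> carrier S"
  shows "quot_proj \<alpha> a \<otimes>\<^bsub>quot S \<alpha>\<^esub> quot_proj \<alpha> b = quot_proj \<alpha> (a \<otimes> b)"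
proof -
  have "quot_proj \<alpha> (x \<otimes> y) = quot_proj \<alpha> (a \<otimes> b)"
    if "x \<in> quot_proj \<alpha> a" "y \<in> quot_proj \<alpha> b" for x y
  proof -
    have xy: "(a, x) \<in> snd \<alpha>" "(x, a) \<in> snd \<alpha>" "(b, y) \<in> snd \<alpha>" "(y, b) \<in> snd \<alpha>"
      using that by (simp_all add: quot_proj_def quot_rel_def)
    have "x \<otimes> y \<in> carrier S" "a \<otimes> b \<in> carrier S"
      using snd_carrier[OF xy(1)] snd_carrier[OF xy(3)] by simp_all
    then show ?thesis
      using snd_add[OF xy(2) xy(4)] snd_add[OF xy(1) xy(3)] by (simp add: quot_proj_eq_iff)
  qed
  moreover have "a \<in> quot_proj \<alpha> a" "b \<in> quot_proj \<alpha> b"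
    using assms snd_refl by (simp_all add: quot_proj_def quot_rel_def)
  ultimately have "(\<Union>x\<in>quot_proj \<alpha> a. \<Union>y\<in>quot_proj \<alpha> b. quot_proj \<alpha> (x \<otimes> y)) = quot_proj \<alpha> (a \<otimes> b)"
    by blast
  then show ?thesis by (simp add: quot_def)
qed

lemma quot_le_iff:
  assumes "a \<in> carrier S" "b \<in> carrier S"
  shows "(quot_proj \<alpha> a, quot_proj \<alpha> b) \<in> quot_le \<alpha> \<longleftrightarrow> (a, b) \<in> snd \<alpha>"
proof
  assume "(quot_proj \<alpha> a, quot_proj \<alpha> b) \<in> quot_le \<alpha>"
  then obtain x y where "quot_proj \<alpha> a = quot_proj \<alpha> x" "quot_proj \<alpha> b = quot_proj \<alpha> y"
      "(x, y) \<in> snd \<alpha>"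
    by (auto simp: quot_le_def)
  then show "(a, b) \<in> snd \<alpha>"
    using assms snd_carrier[of x y] snd_trans[of a x y] snd_trans[of a y b] by (simp add: quot_proj_eq_iff)
qed (auto simp: quot_le_def)

lemma quot_prec_iff:
  assumes "a \<in> carrier S" "b \<in> carrier S"
  shows "(quot_proj \<alpha> a, quot_proj \<alpha> b) \<in> prec (quot S \<alpha>) \<longleftrightarrow> (a, b) \<in> snd \<alpha> O prec S"
proof
  assume "(quot_proj \<alpha> a, quot_proj \<alpha> b) \<in> prec (quot S \<alpha>)"
  then obtain x y z where eq: "quot_proj \<alpha> a = quot_proj \<alpha> x" "quot_proj \<alpha> b = quot_proj \<alpha> y"
      and xz: "(x, z) \<in> snd \<alpha>" and zy: "(z, y) \<in> prec S"
    by (auto simp: quot_def)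
  have "x \<in> carrier S" "y \<in> carrier S"
    using snd_carrier[OF xz] subsetD[OF prec_subset zy] by simp_all
  then have ax: "(a, x) \<in> snd \<alpha>" and yb: "(y, b) \<in> snd \<alpha>"
    using assms eq by (simp_all add: quot_proj_eq_iff)
  obtain u v where zu: "(z, u) \<in> prec S" and uv: "(u, v) \<in> snd \<alpha>" and vb: "(v, b) \<in> prec S"
    using snd_left_cont[OF zy yb] by (elim relcompE) simp
  have "(a, v) \<in> snd \<alpha>"
    by (rule snd_trans[OF ax snd_trans[OF xz snd_trans[OF prec_subset_snd[OF zu] uv]]])
  then show "(a, b) \<in> snd \<alpha> O prec S"
    using vb by (rule relcompI)
next
  assume "(a, b) \<in> snd \<alpha> O prec S"
  then show "(quot_proj \<alpha> a, quot_proj \<alpha> b) \<in> prec (quot S \<alpha>)"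
    unfolding quot_def w_semigroup.simps by blast
qed

end

end

end

(*
  Everything reduces to comparing the preorder of alpha with that of ker(f). Admissibility makes
  the third clause of "alpha <= ker(f)" redundant: it turns the hypothesis into a <= b, hence
  f(a) <= f(b), and continuity of f moves witnesses from below a to below b. If the preorder of
  alpha is contained in that of ker(f), then f is constant on classes because T is partially
  ordered, and the induced map is monotone because the relation of T is auxiliary.
*)
theory Submission
  imports Defs
begin

section \<open>The quotient of a W-semigroup by a normal pair\<close>

context W_semigroup
begin

context
  fixes \<alpha> :: "'a rel \<times> 'a rel"
  assumes normal: "normal_pair S \<alpha>"
begin

lemma quot_carrier: "carrier (quot S \<alpha>) = quot_proj \<alpha> ` carrier S"
  by (auto simp: quot_def quot_proj_def quotient_def)

lemma quot_one: "\<one>\<^bsub>quot S \<alpha>\<^esub> = quot_proj \<alpha> \<one>"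
  by (simp add: quot_def)

lemma quot_comm_monoid: "comm_monoid (quot S \<alpha>)"
  by (rule comm_monoidI)
    (auto simp: quot_carrier quot_one quot_proj_add[OF normal] m_ac)

lemma quot_prec_subset: "prec (quot S \<alpha>) \<subseteq> carrier (quot S \<alpha>) \<times> carrier (quot S \<alpha>)"
proof -
  have "prec (quot S \<alpha>) = {(quot_proj \<alpha> a, quot_proj \<alpha> b) | a b. (a, b) \<in> snd \<alpha> O prec S}"
    by (simp add: quot_def)
  then show ?thesis
    using snd_carrier[OF normal] prec_subset by (auto simp: quot_carrier)
qed

lemma quot_prec_proj: "(a, b) \<in> prec S \<Longrightarrow> (quot_proj \<alpha> a, quot_proj \<alpha> b) \<in> prec (quot S \<alpha>)"
  using prec_subset snd_refl[OF normal] quot_prec_iff[OF normal] by blast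

lemma quot_prec_cases:
  assumes "(x, y) \<in> prec (quot S \<alpha>)"
  obtains a a' b where "x = quot_proj \<alpha> a" "y = quot_proj \<alpha> b" "(a, a') \<in> snd \<alpha>" "(a', b) \<in> prec S"
    "a \<in> carrier S" "a' \<in> carrier S" "b \<in> carrier S"
proof -
  obtain a b a' where "x = quot_proj \<alpha> a" "y = quot_proj \<alpha> b" "(a, a') \<in> snd \<alpha>" "(a', b) \<in> prec S"
    using assms by (auto simp: quot_def)
  then show thesis
    using that snd_carrier[OF normal] prec_subset by blast
qed

text \<open>Left continuity, through \<open>quot_prec_iff\<close>, allows the right-hand
  representative \<open>b\<close> to be prescribed in advance. This is what makes it possible to
  compose relations that meet in a common class.\<close>

lemma quot_prec_projE:
  assumes "(x, quot_proj \<alpha> b) \<in> prec (quot S \<alpha>)" "b \<in> carrier S"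
  obtains a a' where "x = quot_proj \<alpha> a" "(a, a') \<in> snd \<alpha>" "(a', b) \<in> prec S" "a \<in> carrier S"
proof -
  obtain a where a: "x = quot_proj \<alpha> a" "a \<in> carrier S"
    using assms(1) quot_prec_subset by (auto simp: quot_carrier)
  then have "(a, b) \<in> snd \<alpha> O prec S"
    using assms quot_prec_iff[OF normal] by simp
  then show thesis
    using that a by blast
qed

text \<open>A relation in the quotient is represented by a step in \<alpha>'s preorder followed by a
  step in \<open>prec S\<close>. Axioms (W1), (W3) and (W4) of S are applied to the second step, and
  the first is put back in front.\<close>

lemma quot_W_semigroup: "W_semigroup (quot S \<alpha>)"
proof -
  interpret Q: comm_monoid "quot S \<alpha>"
    by (rule quot_comm_monoid)
  show ?thesis
  proof (unfold_locales, goal_cases)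
    case 1
    show ?case by (rule quot_prec_subset)
  next
    case 2
    show ?case
    proof (rule transI)
      fix x y z
      assume xy: "(x, y) \<in> prec (quot S \<alpha>)" and yz: "(y, z) \<in> prec (quot S \<alpha>)"
      obtain b b' c where y: "y = quot_proj \<alpha> b" and z: "z = quot_proj \<alpha> c"
        and b: "(b, b') \<in> snd \<alpha>" "(b', c) \<in> prec S" "b \<in> carrier S" "c \<in> carrier S"
        using yz by (rule quot_prec_cases)
      obtain a a' where x: "x = quot_proj \<alpha> a"
        and a: "(a, a') \<in> snd \<alpha>" "(a', b) \<in> prec S" "a \<in> carrier S"
        using xy[unfolded y] b(3) by (rule quot_prec_projE)
      \<comment> \<open>In the chain from \<open>a\<close> via \<open>a'\<close> and
        \<open>b\<close> to \<open>b'\<close> the middle step is in \<open>prec S\<close>.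
        Admissibility places \<open>prec S\<close> inside the preorder, so the chain collapses to a
        single step of the preorder, and \<open>b'\<close> is already below
        \<open>c\<close>.\<close>
      have "(a, b') \<in> snd \<alpha>"
        by (rule snd_trans[OF normal a(1) snd_trans[OF normal prec_subset_snd[OF normal a(2)] b(1)]])
      then show "(x, z) \<in> prec (quot S \<alpha>)"
        using a b x z quot_prec_iff[OF normal] by blast
    qed
  next
    case (3 x)
    then show ?case
      by (auto simp: quot_carrier quot_one intro: quot_prec_proj zero_prec)
  next
    case (4 x)
    then obtain a where x: "x = quot_proj \<alpha> a" and a: "a \<in> carrier S"
      by (auto simp: quot_carrier)
    obtain s :: "nat \<Rightarrow> 'a" where s: "\<And>k. (s k, a) \<in> prec S" "\<And>k. (s k, s (Suc k)) \<in> prec S"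
      "\<And>b. (b, a) \<in> prec S \<Longrightarrow> \<exists>k. (b, s k) \<in> prec S"
      using W1[OF a] by (auto simp: under_def)
    have "\<exists>k. (y, quot_proj \<alpha> (s k)) \<in> prec (quot S \<alpha>)"
      if y: "(y, x) \<in> prec (quot S \<alpha>)" for y
    proof -
      obtain b b' where b: "y = quot_proj \<alpha> b" "(b, b') \<in> snd \<alpha>" "(b', a) \<in> prec S" "b \<in> carrier S"
        using y[unfolded x] a by (rule quot_prec_projE)
      \<comment> \<open>Cofinality of \<open>s\<close> is used at the intermediate element
        \<open>b'\<close>, which lies below \<open>a\<close> in S itself; \<open>b\<close> then
        follows through the preorder.\<close>
      obtain k where "(b', s k) \<in> prec S"
        using s(3)[OF b(3)] by blast
      moreover have "s k \<in> carrier S"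
        using s(1) prec_subset by blast
      ultimately show ?thesis
        using b quot_prec_iff[OF normal] by blast
    qed
    then show ?case
      using s(1,2) by (intro exI[of _ "\<lambda>k. quot_proj \<alpha> (s k)"]) (auto simp: x under_def quot_prec_proj)
  next
    case (5 x' x y' y)
    from 5(1) obtain a a' b where a: "x' = quot_proj \<alpha> a" "x = quot_proj \<alpha> b" "(a, a') \<in> snd \<alpha>"
      "(a', b) \<in> prec S" "a \<in> carrier S" "a' \<in> carrier S" "b \<in> carrier S"
      by (rule quot_prec_cases)
    from 5(2) obtain c c' d where c: "y' = quot_proj \<alpha> c" "y = quot_proj \<alpha> d" "(c, c') \<in> snd \<alpha>"
      "(c', d) \<in> prec S" "c \<in> carrier S" "c' \<in> carrier S" "d \<in> carrier S"
      by (rule quot_prec_cases)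
    have "(a \<otimes> c, b \<otimes> d) \<in> snd \<alpha> O prec S"
      by (rule relcompI[OF snd_add[OF normal a(3) c(3)] W3[OF a(4) c(4)]])
    then show ?case
      using a c by (simp add: quot_proj_add[OF normal] quot_prec_iff[OF normal])
  next
    case (6 y z x)
    then obtain b c where y: "y = quot_proj \<alpha> b" and z: "z = quot_proj \<alpha> c"
      and b: "b \<in> carrier S" and c: "c \<in> carrier S"
      by (auto simp: quot_carrier)
    have "(x, quot_proj \<alpha> (b \<otimes> c)) \<in> prec (quot S \<alpha>)" "b \<otimes> c \<in> carrier S"
      using 6(3) b c by (simp_all add: y z quot_proj_add[OF normal])
    then obtain a a' where a: "x = quot_proj \<alpha> a" "(a, a') \<in> snd \<alpha>" "(a', b \<otimes> c) \<in> prec S"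
      "a \<in> carrier S"
      by (rule quot_prec_projE)
    \<comment> \<open>(W4) is applied to the intermediate \<open>a'\<close>; prefixing the step from
      \<open>a\<close> to \<open>a'\<close> gives the relation between classes.\<close>
    obtain b' c' where bc: "(b', b) \<in> prec S" "(c', c) \<in> prec S" "(a', b' \<otimes> c') \<in> prec S"
      using W4[OF b c a(3)] by blast
    then have carrier: "b' \<in> carrier S" "c' \<in> carrier S"
      using prec_subset by auto
    have "(x, quot_proj \<alpha> (b' \<otimes> c')) \<in> prec (quot S \<alpha>)"
      using a bc carrier quot_prec_iff[OF normal] by blast
    then show ?case
      using bc carrier by (auto simp: y z quot_proj_add[OF normal] intro!: quot_prec_proj exI)
  qed
qed

end

end

section \<open>The kernel of a W-morphism and maps induced on the quotient\<close>

context W_morphism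
begin

lemma image_carrier: "a \<in> carrier S \<Longrightarrow> f a \<in> carrier T"
  using additive by (rule hom_in_carrier)

lemma W_ker_iff:
  assumes "a \<in> carrier S" "b \<in> carrier S"
  shows "(a, b) \<in> snd (W_ker S T f) \<longleftrightarrow> (f a, f b) \<in> W_le T"
  using assms by (simp add: W_ker_def induced_le_def image_carrier)

text \<open>Continuity of \<open>f\<close> turns a witness below \<open>a\<close> into one below
  \<open>b\<close>, which supplies the third clause in the order of pairs.\<close>

lemma under_W_ker_mono:
  assumes "(a, b) \<in> snd (W_ker S T f)"
  shows "under (snd (W_ker S T f) O prec S) a \<subseteq> under (snd (W_ker S T f) O prec S) b"
proof
  fix c assume "c \<in> under (snd (W_ker S T f) O prec S) a"
  then obtain m where cm: "(c, m) \<in> snd (W_ker S T f)" and ma: "(m, a) \<in> prec S"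
    by (auto simp: under_def)
  have b: "b \<in> carrier S" and "(f m, f b) \<in> prec T"
    using assms monotone[OF ma] by (auto simp: W_ker_def under_def)
  then obtain b' where b': "(b', b) \<in> prec S" "(f m, f b') \<in> prec T"
    using continuous by blast
  \<comment> \<open>Transitivity weakens \<open>prec T\<close> to the induced preorder, so
    \<open>b'\<close> can replace \<open>m\<close> as the intermediate element.\<close>
  have "under (prec T) (f m) \<subseteq> under (prec T) (f b')"
    unfolding under_def using transD[OF T.prec_trans _ b'(2)] by blast
  moreover have "b' \<in> carrier S"
    using b'(1) S.prec_subset by auto
  ultimately have "(c, b') \<in> snd (W_ker S T f)"
    using cm by (auto simp: W_ker_def)
  then show "c \<in> under (snd (W_ker S T f) O prec S) b"
    using b'(1) by (auto simp: under_def)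
qed

lemma pair_le_W_ker_iff:
  assumes "normal_pair S \<alpha>"
  shows "pair_le (carrier S) \<alpha> (W_ker S T f) \<longleftrightarrow> snd \<alpha> \<subseteq> snd (W_ker S T f)"
proof
  assume le: "snd \<alpha> \<subseteq> snd (W_ker S T f)"
  have fst: "fst \<alpha> = prec S" "fst (W_ker S T f) = prec S" and adm: "admissible_pair (carrier S) \<alpha>"
    using assms by (simp_all add: normal_pair_def W_ker_def)
  have "(a, b) \<in> snd (W_ker S T f)"
    if "a \<in> carrier S" "b \<in> carrier S" "under (snd \<alpha> O prec S) a \<subseteq> under (snd \<alpha> O prec S) b" for a b
    using adm that le fst by (auto simp: admissible_pair_def)
  then show "pair_le (carrier S) \<alpha> (W_ker S T f)"
    unfolding pair_le_def fst using le under_W_ker_mono by blast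
qed (simp add: pair_le_def)

text \<open>The values of \<open>h\<close> on classes are forced by \<open>f\<close>, so this
  property of \<open>h\<close> is a statement about \<alpha> and \<open>f\<close> alone, shared by
  all lifts.\<close>

lemma quot_lift_order_preserving_iff:
  assumes normal: "normal_pair S \<alpha>" and h: "\<And>a. a \<in> carrier S \<Longrightarrow> h (quot_proj \<alpha> a) = f a"
  shows "order_preserving (carrier (quot S \<alpha>)) (quot_le \<alpha>) (W_le T) h \<longleftrightarrow>
    snd \<alpha> \<subseteq> snd (W_ker S T f)"
proof -
  have "order_preserving (carrier (quot S \<alpha>)) (quot_le \<alpha>) (W_le T) h \<longleftrightarrow>
      (\<forall>a\<in>carrier S. \<forall>b\<in>carrier S. (a, b) \<in> snd \<alpha> \<longrightarrow> (a, b) \<in> snd (W_ker S T f))"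
    by (simp add: order_preserving_def S.quot_carrier[OF normal] S.quot_le_iff[OF normal] h W_ker_iff
        cong: ball_cong)
  then show ?thesis
    using S.snd_carrier[OF normal] by auto
qed

text \<open>Reflecting the order adds the reverse inclusion of preorders. Both pairs have first
  component \<open>prec S\<close>, so equal preorders mean equal pairs.\<close>

lemma quot_lift_order_embedding_iff:
  assumes normal: "normal_pair S \<alpha>" and h: "\<And>a. a \<in> carrier S \<Longrightarrow> h (quot_proj \<alpha> a) = f a"
  shows "order_embedding (carrier (quot S \<alpha>)) (quot_le \<alpha>) (W_le T) h \<longleftrightarrow> \<alpha> = W_ker S T f"
proof -
  have "order_embedding (carrier (quot S \<alpha>)) (quot_le \<alpha>) (W_le T) h \<longleftrightarrow>
      (\<forall>a\<in>carrier S. \<forall>b\<in>carrier S. (a, b) \<in> snd \<alpha> \<longleftrightarrow> (a, b) \<in> snd (W_ker S T f))"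
    by (simp add: order_embedding_def S.quot_carrier[OF normal] S.quot_le_iff[OF normal] h W_ker_iff
        cong: ball_cong)
  also have "\<dots> \<longleftrightarrow> snd \<alpha> = snd (W_ker S T f)"
  proof -
    have "snd \<alpha> \<subseteq> carrier S \<times> carrier S" "snd (W_ker S T f) \<subseteq> carrier S \<times> carrier S"
      using S.snd_preorder[OF normal] by (auto simp: preorder_on_def W_ker_def)
    then show ?thesis by blast
  qed
  also have "\<dots> \<longleftrightarrow> \<alpha> = W_ker S T f"
    using normal by (simp add: prod_eq_iff normal_pair_def W_ker_def)
  finally show ?thesis .
qed

lemma quot_lift_exists:
  assumes faithful: "faithful_W_semigroup T" and normal: "normal_pair S \<alpha>"
    and le: "snd \<alpha> \<subseteq> snd (W_ker S T f)"
  shows "\<exists>h. W_morphism (quot S \<alpha>) T h \<and> (\<forall>a\<in>carrier S. h (quot_proj \<alpha> a) = f a)"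
proof -
  interpret T': faithful_W_semigroup T by (rule faithful)
  interpret Q: W_semigroup "quot S \<alpha>" by (rule S.quot_W_semigroup[OF normal])
  have f_le: "(f a, f b) \<in> W_le T" if "(a, b) \<in> snd \<alpha>" for a b
    using that le S.snd_carrier[OF normal that] W_ker_iff by blast
  \<comment> \<open>The map evaluates \<open>f\<close> at an arbitrary representative. Equivalent
    elements have images below each other in T, so antisymmetry makes the choice immaterial.\<close>
  define h where "h A = f (SOME a. a \<in> A)" for A
  have h: "h (quot_proj \<alpha> a) = f a" if a: "a \<in> carrier S" for a
  proof -
    have "a \<in> quot_proj \<alpha> a"
      using S.snd_refl[OF normal a] by (simp add: quot_proj_def quot_rel_def)
    then have "(SOME x. x \<in> quot_proj \<alpha> a) \<in> quot_proj \<alpha> a"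
      by (rule someI)
    then have "(h (quot_proj \<alpha> a), f a) \<in> W_le T" "(f a, h (quot_proj \<alpha> a)) \<in> W_le T"
      unfolding h_def by (auto simp: quot_proj_def quot_rel_def intro: f_le)
    then show ?thesis
      using T'.W_le_partial_order unfolding partial_order_on_def by (blast dest: antisymD)
  qed
  have "W_morphism (quot S \<alpha>) T h"
  proof (unfold_locales, goal_cases)
    case 1
    show ?case
      by (rule homI) (auto simp: S.quot_carrier[OF normal] S.quot_proj_add[OF normal] h image_carrier
          hom_mult[OF additive])
  next
    case 2
    show ?case by (simp add: S.quot_one[OF normal] h zero)
  next
    case (3 x y)
    then obtain a a' b where x: "x = quot_proj \<alpha> a" and y: "y = quot_proj \<alpha> b"
      and a: "(a, a') \<in> snd \<alpha>" "(a', b) \<in> prec S" "a \<in> carrier S" "b \<in> carrier S"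
      by (rule S.quot_prec_cases[OF normal])
    have "(f b, f b) \<in> W_le T"
      by (rule f_le[OF S.snd_refl[OF normal a(4)]])
    \<comment> \<open>Reflexivity at \<open>f b\<close> pads the composite to the three-factor form
      that an auxiliary relation absorbs.\<close>
    then have "(f a, f b) \<in> W_le T O prec T O W_le T"
      using f_le[OF a(1)] monotone[OF a(2)] by blast
    then show ?case
      using T'.prec_auxiliary a by (auto simp: auxiliary_def x y h)
  next
    case (4 x y)
    then obtain a where x: "x = quot_proj \<alpha> a" and a: "a \<in> carrier S"
      by (auto simp: S.quot_carrier[OF normal])
    \<comment> \<open>Continuity of \<open>f\<close> gives \<open>a'\<close>, whose class is the
      witness for continuity of \<open>h\<close>.\<close>
    obtain a' where a': "(a', a) \<in> prec S" "(y, f a') \<in> prec T"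
      using 4(2) continuous[OF a] by (auto simp: x h a)
    then have "h (quot_proj \<alpha> a') = f a'"
      using S.prec_subset by (intro h) auto
    then show ?case
      using a' S.quot_prec_proj[OF normal a'(1)] by (auto simp: x)
  qed
  then show ?thesis
    using h by auto
qed

end

theorem theorem1:
  fixes S :: "('a, 'c) w_semigroup_scheme"
    and T :: "('b, 'd) w_semigroup_scheme"
    and f :: "'a \<Rightarrow> 'b"
    and \<alpha> :: "'a rel \<times> 'a rel"
  assumes "W_semigroup S"
    and "faithful_W_semigroup T"
    and "W_morphism S T f"
    and "normal_pair S \<alpha>"
  shows "((\<exists>h. W_morphism (quot S \<alpha>) T h \<and>
            order_preserving (carrier (quot S \<alpha>)) (quot_le \<alpha>) (W_le T) h \<and>
            (\<forall>a \<in> carrier S. h (quot_proj \<alpha> a) = f a))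
          \<longleftrightarrow> pair_le (carrier S) \<alpha> (W_ker S T f)) \<and>
         (\<alpha> = W_ker S T f \<longleftrightarrow>
          (\<exists>h. W_morphism (quot S \<alpha>) T h \<and>
            order_preserving (carrier (quot S \<alpha>)) (quot_le \<alpha>) (W_le T) h \<and>
            (\<forall>a \<in> carrier S. h (quot_proj \<alpha> a) = f a) \<and>
            order_embedding (carrier (quot S \<alpha>)) (quot_le \<alpha>) (W_le T) h))"
proof -
  interpret W_morphism S T f by (rule assms(3))
  note normal = assms(4)
  let ?lift = "\<lambda>h. \<forall>a \<in> carrier S. h (quot_proj \<alpha> a) = f a"
  have preserving: "order_preserving (carrier (quot S \<alpha>)) (quot_le \<alpha>) (W_le T) h \<longleftrightarrow>
      snd \<alpha> \<subseteq> snd (W_ker S T f)" if "?lift h" for h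
    by (rule quot_lift_order_preserving_iff[OF normal]) (rule bspec[OF that])
  have embedding: "order_embedding (carrier (quot S \<alpha>)) (quot_le \<alpha>) (W_le T) h \<longleftrightarrow>
      \<alpha> = W_ker S T f" if "?lift h" for h
    by (rule quot_lift_order_embedding_iff[OF normal]) (rule bspec[OF that])
  have lift: "\<exists>h. W_morphism (quot S \<alpha>) T h \<and> ?lift h" if le: "snd \<alpha> \<subseteq> snd (W_ker S T f)"
    by (rule quot_lift_exists[OF assms(2) normal le])
  \<comment> \<open>Equality with the kernel yields the inclusion that produces a lift, and
    \<open>embedding\<close> makes this lift an order-embedding. Conversely,
    \<open>embedding\<close> at any embedding lift returns the equality.\<close>
  have "snd \<alpha> \<subseteq> snd (W_ker S T f)" if "\<alpha> = W_ker S T f"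
    using that by simp
  then show ?thesis
    unfolding pair_le_W_ker_iff[OF normal]
    using preserving embedding lift by (smt (verit))
qed

end
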